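(* Let $m$ be a positive integer, let $h$ be a positive divisor of $m$ with $h<m$, and suppose $m/h$ is odd. Put $q=2^m$, $D_0=\{x\in\mathbb{F}_q^*:\mathrm{Tr}(x)=0\}$ and $$\mathcal{C}_{D_0}=\left\{\left(\mathrm{Tr}(x d^{2^h+1})\right)_{d\in D_0}: x\in\mathbb{F}_q\right\}.$$ Then $\mathcal{C}_{D_0}$ is a $[2^{m-1}-1,\,m]$ binary linear code whose weight distribution is as follows: there is exactly $1$ codeword of weight $0$; the number of codewords of weight $2^{m-2}$ is $2^m-1-2^{m-h}$; the number of codewords of weight $2^{m-2}-2^{\frac{m+h-4}{2}}$ is $2^{m-h-1}+2^{\frac{m-h-2}{2}}$; the number of codewords of weight $2^{m-2}+2^{\frac{m+h-4}{2}}$ is $2^{m-h-1}-2^{\frac{m-h-2}{2}}$; and there are no codewords of any other weight.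
   Context: $\mathbb{F}_q$ is the finite field with $q=2^m$ elements, $\mathbb{F}_q^*$ its multiplicative group, and $\mathrm{Tr}:\mathbb{F}_q\to\mathbb{F}_2$ is the absolute trace. An $[n,k]$ binary linear code is a $k$-dimensional $\mathbb{F}_2$-subspace of $\mathbb{F}_2^n$; the (Hamming) weight of a codeword is its number of nonzero coordinates; the weight distribution records, for each $i$, the number of codewords of weight $i$. *)

theory Defs
  imports
    "HOL-Computational_Algebra.Primes"
    "HOL-Library.Cardinality"
    "HOL-Library.Z2"
    "HOL-Library.Function_Algebras"
    "HOL.Vector_Spaces"
begin

text \<open>
  The absolute trace of the field with \<open>2 ^ m\<close> elements, with values in the two-element field
  \<^typ>\<open>bit\<close>. The sum lies in the prime subfield, which \<^term>\<open>of_bit\<close> identifies with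
  \<^typ>\<open>bit\<close>; that the description is well-defined is the lemma \<open>of_bit_abs_trace\<close>.
\<close>

definition abs_trace :: "nat \<Rightarrow> 'a::finite_field \<Rightarrow> bit" where
  "abs_trace m x = (THE b. of_bit b = (\<Sum>i<m. x ^ (2 ^ i)))"

lemma CHAR_eq_2:
  assumes "CARD('a::finite_field) = 2 ^ m"
  shows "CHAR('a) = 2"
proof -
  have "(\<Sum>x\<in>UNIV. x + 1) = (\<Sum>x\<in>UNIV. x :: 'a)"
    by (rule sum.reindex_bij_witness[where i = "\<lambda>x. x - 1" and j = "\<lambda>x. x + 1"]) simp_all
  then have "of_nat CARD('a) = (0 :: 'a)"
    by (simp add: sum.distrib)
  then have "CHAR('a) dvd CARD('a)"
    by (simp add: of_nat_eq_0_iff_char_dvd)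
  then have "CHAR('a) dvd 2 ^ m"
    by (simp add: assms)
  then have "CHAR('a) dvd 2"
    using prime_dvd_power CHAR_prime by blast
  then show ?thesis
    using CHAR_prime[where ?'a = 'a] primes_dvd_imp_eq two_is_prime_nat by blast
qed

lemma of_bit_abs_trace:
  fixes x :: "'a::finite_field"
  assumes "CARD('a) = 2 ^ m"
  shows "of_bit (abs_trace m x) = (\<Sum>i<m. x ^ (2 ^ i))"
proof -
  let ?s = "\<Sum>i<m. x ^ (2 ^ i)"
  have "?s ^ 2 = (\<Sum>i<m. (x ^ (2 ^ i)) ^ 2)"
    by (rule freshmans_dream_sum) (simp_all add: CHAR_eq_2[OF assms])
  also have "\<dots> = (\<Sum>i<m. x ^ (2 ^ Suc i))"
    by (simp add: mult.commute flip: power_mult)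
  finally have "?s ^ 2 + x = (\<Sum>i<Suc m. x ^ (2 ^ i))"
    by (subst sum.lessThan_Suc_shift) (simp add: add.commute)
  also have "\<dots> = ?s + x"
    using finite_field_power_card_eq_same[of x] by (simp add: assms)
  finally have "?s ^ 2 = ?s"
    by simp
  then have "?s * (?s - 1) = 0"
    by (simp add: power2_eq_square algebra_simps)
  then have "?s = of_bit 0 \<or> ?s = of_bit 1"
    by auto
  then obtain b :: bit where b: "of_bit b = ?s"
    by metis
  have "abs_trace m x = b"
    unfolding abs_trace_def
  proof (rule the_equality[where a = b])
    show "of_bit b = ?s"
      by (fact b)
  next
    fix c :: bit
    assume "of_bit c = ?s"
    then have "(of_bit c :: 'a) = of_bit b"
      by (simp only: b)
    then show "c = b"
      by (cases c; cases b) simp_all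
  qed
  then show ?thesis
    by (simp only: b)
qed

text \<open>
  Binary words whose coordinates are indexed by a set \<open>I\<close> are functions into \<^typ>\<open>bit\<close> that
  vanish outside \<open>I\<close>.
\<close>

definition words :: "'i set \<Rightarrow> ('i \<Rightarrow> bit) set" where
  "words I = {u. \<forall>i. i \<notin> I \<longrightarrow> u i = 0}"

definition word_scale :: "bit \<Rightarrow> ('i \<Rightarrow> bit) \<Rightarrow> 'i \<Rightarrow> bit" where
  "word_scale c u = (\<lambda>i. c * u i)"

global_interpretation F2: vector_space word_scale
  by standard (simp_all only: word_scale_def fun_eq_iff plus_fun_apply distrib_left distrib_right
    mult.assoc mult_1 simp_thms)

text \<open>\<open>C\<close> is an \<open>[n, k]\<close> binary linear code with coordinates indexed by \<open>I\<close>.\<close>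

definition binary_linear_code :: "'i set \<Rightarrow> nat \<Rightarrow> nat \<Rightarrow> ('i \<Rightarrow> bit) set \<Rightarrow> bool" where
  "binary_linear_code I n k C \<longleftrightarrow>
     finite I \<and> card I = n \<and> C \<subseteq> words I \<and> F2.subspace C \<and> F2.dim C = k"

definition hamming_weight :: "'i set \<Rightarrow> ('i \<Rightarrow> bit) \<Rightarrow> nat" where
  "hamming_weight I u = card {i \<in> I. u i \<noteq> 0}"

definition weight_count :: "'i set \<Rightarrow> ('i \<Rightarrow> bit) set \<Rightarrow> nat \<Rightarrow> nat" where
  "weight_count I C w = card {c \<in> C. hamming_weight I c = w}"

definition trace_zero_set :: "nat \<Rightarrow> 'a::finite_field set" where
  "trace_zero_set m = {x. x \<noteq> 0 \<and> abs_trace m x = 0}"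

definition trace_code :: "nat \<Rightarrow> nat \<Rightarrow> 'a::finite_field set \<Rightarrow> ('a \<Rightarrow> bit) set" where
  "trace_code m h D =
     {\<lambda>d. if d \<in> D then abs_trace m (x * d ^ (2 ^ h + 1)) else 0 | x. True}"

end

theory Submission
  imports Defs "HOL-Computational_Algebra.Polynomial"
begin

text \<open>
  Put \<open>N = 2 ^ h + 1\<close>, let \<open>\<chi> x = (-1) ^ Tr x\<close> and \<open>W b = (\<Sum>y. \<chi> (y ^ N + b * y))\<close>. As \<open>m / h\<close> is
  odd, \<open>y \<mapsto> y ^ N\<close> is a permutation, so every \<open>x \<noteq> 0\<close> is \<open>(1 / b) ^ N\<close> for a unique \<open>b \<noteq> 0\<close>, and
  the codeword of \<open>x\<close> has weight \<open>(2 ^ m - W b) / 4\<close>. Squaring the sum \<open>W b\<close> gives \<open>2 ^ m\<close> times the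
  sum of \<open>\<chi> ((1 + b) * u)\<close> over the \<open>u\<close> in the subfield of order \<open>2 ^ h\<close>, so \<open>W b\<close> is \<open>0\<close> or
  \<open>\<plusminus> 2 ^ ((m + h) / 2)\<close>. The frequencies of these values follow from \<open>(\<Sum>b. W b) = 2 ^ m\<close> and
  \<open>(\<Sum>b. (W b)\<^sup>2) = 4 ^ m\<close>.
\<close>

section \<open>Binary linear spaces\<close>

text \<open>Over the two-element field a linear combination of \<open>B\<close> is the sum of a
  subset of \<open>B\<close>, and independence makes different subsets have different sums.\<close>

lemma F2_card_span:
  assumes "F2.independent B" "finite B"
  shows "card (F2.span B) = 2 ^ card B"
proof -
  have "bij_betw (\<lambda>S. \<Sum>S) (Pow B) (F2.span B)"
    unfolding bij_betw_def
  proof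
    show "inj_on (\<lambda>S. \<Sum>S) (Pow B)"
    proof (rule inj_onI)
      fix S T assume ST: "S \<in> Pow B" "T \<in> Pow B" "\<Sum>S = \<Sum>T"
      \<comment> \<open>The difference of the two indicator functions: a linear relation on
        \<open>B\<close> that independence forces to be trivial.\<close>
      define u where "u v = (of_bool (v \<in> S) :: bit) - of_bool (v \<in> T)" for v
      have sum_of: "(\<Sum>v\<in>B. word_scale (of_bool (v \<in> R)) v) = \<Sum>R" if "R \<subseteq> B" for R
      proof -
        have "(\<Sum>v\<in>B. word_scale (of_bool (v \<in> R)) v) = (\<Sum>v\<in>B. if v \<in> R then v else 0)"
          by (intro sum.cong refl) auto
        also have "\<dots> = \<Sum>(B \<inter> R)"
          using assms(2) by (simp add: sum.inter_restrict)
        finally show ?thesis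
          using that by (simp add: Int_absorb1)
      qed
      have "(\<Sum>v\<in>B. word_scale (u v) v) = \<Sum>S - \<Sum>T"
        unfolding u_def F2.scale_left_diff_distrib sum_subtractf
        using ST by (simp add: sum_of)
      then have "(\<Sum>v\<in>B. word_scale (u v) v) = 0"
        using ST by (simp only: diff_self)
      then have "\<forall>v\<in>B. u v = 0"
        using F2.independentD[OF assms(1,2) subset_refl] by blast
      then have "\<forall>v\<in>B. v \<in> S \<longleftrightarrow> v \<in> T"
        by (auto simp: u_def of_bool_def split: if_splits)
      then show "S = T"
        using ST by blast
    qed
    show "(\<lambda>S. \<Sum>S) ` Pow B = F2.span B"
    proof
      show "(\<lambda>S. \<Sum>S) ` Pow B \<subseteq> F2.span B"
        by (auto intro!: F2.span_sum intro: F2.span_base)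
      show "F2.span B \<subseteq> (\<lambda>S. \<Sum>S) ` Pow B"
      proof
        fix w assume "w \<in> F2.span B"
        then obtain u where w: "w = (\<Sum>v\<in>B. word_scale (u v) v)"
          using F2.span_finite[OF assms(2)] by auto
        have "word_scale (u v) v = (if u v = 1 then v else 0)" for v
          by (cases "u v") auto
        then have "w = \<Sum>(B \<inter> {v. u v = 1})"
          using assms(2) by (simp add: w sum.inter_restrict)
        then show "w \<in> (\<lambda>S. \<Sum>S) ` Pow B"
          by blast
      qed
    qed
  qed
  then have "card (Pow B) = card (F2.span B)"
    by (rule bij_betw_same_card)
  then show ?thesis
    using assms(2) by (simp add: card_Pow)
qed

text \<open>Reduces the dimension of the code to a count of its words.\<close>

lemma F2_dim_eqI:
  assumes "F2.subspace V" "finite V" "card V = 2 ^ k"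
  shows "F2.dim V = k"
proof -
  obtain B where B: "B \<subseteq> V" "F2.independent B" "V \<subseteq> F2.span B" "card B = F2.dim V"
    using F2.basis_exists by blast
  have "F2.span B = V"
    using B assms(1) by (simp add: F2.span_minimal subset_antisym)
  then have "(2::nat) ^ F2.dim V = 2 ^ k"
    using F2_card_span[OF B(2)] B assms finite_subset by metis
  then show ?thesis
    by simp
qed

section \<open>Additive polynomials and the additive character\<close>

lemma card_additive_polynomial_roots_le:
  fixes h k :: nat
  assumes "h > 0"
  shows "card {x::'a::finite_field. (\<Sum>i<Suc k. x ^ (2 ^ (h * i))) = 0} \<le> 2 ^ (h * k)"
proof -
  define p :: "'a poly" where "p = (\<Sum>i<Suc k. monom 1 (2 ^ (h * i)))"
  \<comment> \<open>As \<open>h > 0\<close>, the exponents are distinct, so only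
    \<open>i = k\<close> reaches the top coefficient.\<close>
  have "coeff p (2 ^ (h * k)) = (\<Sum>i<Suc k. if i = k then 1 else 0)"
    using assms unfolding p_def coeff_sum by (intro sum.cong) auto
  then have "coeff p (2 ^ (h * k)) = 1"
    by simp
  then have "p \<noteq> 0"
    by auto
  moreover have "degree p \<le> 2 ^ (h * k)"
    unfolding p_def
    by (intro degree_sum_le) (auto intro!: order.trans[OF degree_monom_le] power_increasing)
  moreover have "poly p x = (\<Sum>i<Suc k. x ^ (2 ^ (h * i)))" for x
    by (simp add: p_def poly_sum poly_monom)
  ultimately show ?thesis
    using card_poly_roots_bound[of p] by simp
qed

definition trace_char :: "nat \<Rightarrow> 'a::finite_field \<Rightarrow> int" where
  "trace_char m x = (if abs_trace m x = 0 then 1 else - 1)"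

locale binary_field =
  fixes m :: nat and field_type :: "'a::finite_field itself"
  assumes card_field: "CARD('a) = 2 ^ m" and m_pos: "m > 0"
begin

lemma add_self [simp]: "(x::'a) + x = 0"
proof -
  have "(of_nat 2 :: 'a) = 0"
    using CHAR_eq_2[OF card_field] of_nat_CHAR by metis
  then show ?thesis
    by (simp flip: mult_2)
qed

lemma add_self_left [simp]: "(x::'a) + (x + y) = y"
  by (simp flip: add.assoc)

lemma uminus_eq [simp]: "- (x::'a) = x"
  using add_self by (simp add: minus_unique)

lemma frobenius_add: "((x::'a) + y) ^ (2 ^ k) = x ^ (2 ^ k) + y ^ (2 ^ k)"
proof (induction k)
  case (Suc k)
  have "((x + y) ^ (2 ^ k))\<^sup>2 = (x ^ (2 ^ k))\<^sup>2 + (y ^ (2 ^ k))\<^sup>2"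
    unfolding Suc by (simp add: power2_eq_square algebra_simps)
  then show ?case
    by (simp add: power_mult mult.commute[of 2])
qed simp

lemma frobenius_inj: "(x::'a) ^ (2 ^ k) = y ^ (2 ^ k) \<Longrightarrow> x = y"
  using frobenius_add[of x y k]
  by (metis add_self add_eq_0_iff2 power_not_zero uminus_eq)

lemma frobenius_bij: "bij (\<lambda>x::'a. x ^ (2 ^ k))"
proof -
  have "inj (\<lambda>x::'a. x ^ (2 ^ k))"
    by (rule injI) (rule frobenius_inj)
  then show ?thesis
    by (simp only: bij_def finite_UNIV_inj_surj[OF finite] simp_thms)
qed

lemma of_bit_add: "of_bit (a + b) = (of_bit a + of_bit b :: 'a)"
  by (cases a; cases b) auto

lemma of_bit_eq_iff: "of_bit a = (of_bit b :: 'a) \<longleftrightarrow> a = b"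
  by (cases a; cases b) auto

lemma abs_trace_add: "abs_trace m ((x::'a) + y) = abs_trace m x + abs_trace m y"
proof -
  have "of_bit (abs_trace m (x + y)) = (of_bit (abs_trace m x) + of_bit (abs_trace m y) :: 'a)"
    by (simp only: of_bit_abs_trace[OF card_field] frobenius_add sum.distrib)
  then show ?thesis
    by (simp only: of_bit_eq_iff flip: of_bit_add)
qed

lemma abs_trace_0 [simp]: "abs_trace m (0::'a) = 0"
  using abs_trace_add[of 0 0] by simp

text \<open>Squaring shifts the trace sum by one place; after adding \<open>x\<close>, the surplus
  last term is \<open>x ^ (2 ^ m) = x\<close>.\<close>

lemma abs_trace_square: "abs_trace m ((x::'a)\<^sup>2) = abs_trace m x"
proof -
  have "x\<^sup>2 ^ (2 ^ i) = (x ^ (2 ^ i))\<^sup>2" for i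
    by (simp flip: power_mult add: mult.commute)
  then have "(of_bit (abs_trace m (x\<^sup>2)) :: 'a) = (\<Sum>i<m. x ^ (2 ^ Suc i))"
    by (simp only: of_bit_abs_trace[OF card_field] power_Suc2 power_mult)
  also have "\<dots> + x = (\<Sum>i<Suc m. x ^ (2 ^ i))"
    by (subst sum.lessThan_Suc_shift) (simp add: add.commute)
  also have "\<dots> = of_bit (abs_trace m x) + x"
    using finite_field_power_card_eq_same[of x]
    by (simp only: of_bit_abs_trace[OF card_field] card_field sum.lessThan_Suc)
  finally show ?thesis
    by (simp only: add_right_cancel of_bit_eq_iff)
qed

lemma abs_trace_frobenius: "abs_trace m ((x::'a) ^ (2 ^ k)) = abs_trace m x"
proof (induction k)
  case (Suc k)
  have "x ^ (2 ^ Suc k) = (x ^ (2 ^ k))\<^sup>2"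
    by (simp flip: power_mult add: mult.commute)
  then show ?case
    using Suc by (simp add: abs_trace_square)
qed simp

text \<open>Otherwise a polynomial of degree \<open>2 ^ (m - 1)\<close> would have
  \<open>2 ^ m\<close> roots.\<close>

lemma abs_trace_nonzero: "\<exists>x::'a. abs_trace m x \<noteq> 0"
proof (rule ccontr)
  assume "\<not> ?thesis"
  then have "(\<Sum>i<m. x ^ (2 ^ i)) = 0" for x :: 'a
    by (simp flip: of_bit_abs_trace[OF card_field])
  then have "2 ^ m \<le> (2::nat) ^ (m - 1)"
    using card_additive_polynomial_roots_le[of 1 "m - 1", where ?'a = 'a] m_pos card_field by simp
  then show False
    using m_pos by simp
qed

abbreviation \<chi> :: "'a \<Rightarrow> int" where "\<chi> \<equiv> trace_char m"

lemma \<chi>_add: "\<chi> (x + y) = \<chi> x * \<chi> y"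
  unfolding trace_char_def abs_trace_add by (cases "abs_trace m x"; cases "abs_trace m y") auto

lemma \<chi>_0 [simp]: "\<chi> 0 = 1"
  by (simp add: trace_char_def)

lemma \<chi>_frobenius: "\<chi> (x ^ (2 ^ k)) = \<chi> x"
  by (simp add: trace_char_def abs_trace_frobenius)

text \<open>Orthogonality: if some \<open>z\<close> in \<open>K\<close> has
  \<open>\<chi> (a * z) = - 1\<close>, translation by \<open>z\<close> is an involution of
  \<open>K\<close> that negates the sum.\<close>

lemma sum_\<chi>_subgroup:
  assumes "\<And>x y. x \<in> K \<Longrightarrow> y \<in> K \<Longrightarrow> x + y \<in> K"
  shows "(\<Sum>y\<in>K. \<chi> (a * y)) = (if \<forall>y\<in>K. \<chi> (a * y) = 1 then int (card K) else 0)"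
proof (cases "\<forall>y\<in>K. \<chi> (a * y) = 1")
  case False
  then obtain z where z: "z \<in> K" "\<chi> (a * z) = - 1"
    by (auto simp: trace_char_def split: if_splits)
  have "(\<Sum>y\<in>K. \<chi> (a * y)) = (\<Sum>y\<in>K. \<chi> (a * (y + z)))"
    by (rule sum.reindex_bij_witness[where i = "\<lambda>y. y + z" and j = "\<lambda>y. y + z"])
      (use z assms in \<open>auto simp: add.assoc\<close>)
  also have "\<dots> = - (\<Sum>y\<in>K. \<chi> (a * y))"
    by (simp add: distrib_left \<chi>_add z sum_negf)
  finally show ?thesis
    using False by auto
qed simp

lemma sum_\<chi>_mult: "(\<Sum>y\<in>UNIV. \<chi> (a * y)) = (if a = 0 then 2 ^ m else 0)"
proof (cases "a = 0")
  case False
  obtain x :: 'a where "abs_trace m x \<noteq> 0"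
    using abs_trace_nonzero by blast
  then have "\<chi> (a * (x / a)) \<noteq> 1"
    using False by (simp add: trace_char_def)
  then have "\<not> (\<forall>y\<in>UNIV. \<chi> (a * y) = 1)"
    by blast
  then show ?thesis
    using sum_\<chi>_subgroup[of UNIV a] False by simp
qed (simp add: card_field)

lemma sum_\<chi>: "(\<Sum>y\<in>UNIV. \<chi> y) = 0"
  using sum_\<chi>_mult[of 1] by simp

end

section \<open>The Gold exponent\<close>

text \<open>The explicit \<open>k\<close> encodes that \<open>m / h\<close> is odd and
  \<open>h < m\<close>; exponents such as \<open>(m + h) / 2 = h * (k + 1)\<close> become products
  without division.\<close>

locale gold = binary_field m field_type
  for m :: nat and field_type :: "'a::finite_field itself" +
  fixes h k :: nat
  assumes h_pos: "h > 0" and k_pos: "k > 0" and m_eq: "m = h * (2 * k + 1)"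
begin

abbreviation N :: nat where "N \<equiv> 2 ^ h + 1"

lemma frobenius_m: "(x::'a) ^ (2 ^ m) = x"
  using finite_field_power_card_eq_same[of x] by (simp add: card_field)

text \<open>Oddness of \<open>m / h\<close> enters here: the map \<open>F x = x ^ (2 ^ h)\<close>
  satisfies \<open>F^(2 * k + 1) = id\<close>, so a point fixed by \<open>F^2\<close> is fixed by
  \<open>F\<close>.\<close>

lemma frobenius_twice_fixed:
  assumes "((x::'a) ^ (2 ^ h)) ^ (2 ^ h) = x"
  shows "x ^ (2 ^ h) = x"
proof -
  have *: "x ^ (2 ^ (h * (2 * j))) = x" for j
  proof (induction j)
    case (Suc j)
    have "x ^ (2 ^ (h * (2 * Suc j))) = ((x ^ (2 ^ (h * (2 * j)))) ^ (2 ^ h)) ^ (2 ^ h)"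
      by (simp flip: power_mult power_add add: algebra_simps)
    then show ?case
      using Suc assms by simp
  qed simp
  have "x = x ^ (2 ^ m)"
    by (simp add: frobenius_m)
  also have "\<dots> = (x ^ (2 ^ (h * (2 * k)))) ^ (2 ^ h)"
    by (simp flip: power_mult power_add add: m_eq algebra_simps)
  finally show ?thesis
    by (simp add: *)
qed

text \<open>The hypothesis says that \<open>x ^ (2 ^ h)\<close> is the inverse of \<open>x\<close>.
  Applying the map twice returns \<open>x\<close>, so \<open>x\<close> is already fixed, equals its
  inverse, and has square \<open>1\<close>.\<close>

lemma gold_power_eq_1:
  assumes "(x::'a) ^ N = 1"
  shows "x = 1"
proof -
  have "x \<noteq> 0"
    using assms by auto
  then have inv: "x ^ (2 ^ h) = inverse x"
    using assms by (simp add: field_simps)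
  then have "inverse x = x"
    using frobenius_twice_fixed[of x] by (simp add: power_inverse)
  then have "x * x = 1"
    using \<open>x \<noteq> 0\<close> by (metis right_inverse)
  then have "x ^ (2 ^ 1) = 1 ^ (2 ^ 1)"
    by (simp add: power2_eq_square)
  then show ?thesis
    by (rule frobenius_inj)
qed

lemma gold_power_inj: "(x::'a) ^ N = y ^ N \<Longrightarrow> x = y"
  using gold_power_eq_1[of "x / y"]
  by (cases "y = 0") (auto simp: power_divide)

lemma gold_power_bij: "bij (\<lambda>x::'a. x ^ N)"
proof -
  have "inj (\<lambda>x::'a. x ^ N)"
    by (rule injI) (rule gold_power_inj)
  then show ?thesis
    by (simp only: bij_def finite_UNIV_inj_surj[OF finite] simp_thms)
qed

section \<open>The subfield of order \<open>2 ^ h\<close>\<close>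

definition K :: "'a set" where "K = {u. u ^ (2 ^ h) = u}"

lemma K_add: "u \<in> K \<Longrightarrow> v \<in> K \<Longrightarrow> u + v \<in> K"
  by (simp add: K_def frobenius_add)

lemma zero_in_K: "0 \<in> K"
  by (simp add: K_def)

text \<open>
  \<open>K\<close> is the kernel of \<open>L x = x ^ (2 ^ h) + x\<close>, whose image lies in the kernel of the relative trace.
  The degrees bound both sizes from above, and their product is \<open>2 ^ m\<close>.
\<close>

lemma card_K: "card K = 2 ^ h"
proof -
  define L where "L x = x ^ (2 ^ h) + x" for x :: 'a
  define T where "T x = (\<Sum>i<Suc (2 * k). x ^ (2 ^ (h * i)))" for x :: 'a
  have L_add: "L (x + y) = L x + L y" for x y
    by (simp add: L_def frobenius_add algebra_simps)
  have L_0: "L x = 0 \<longleftrightarrow> x \<in> K" for x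
    by (auto simp: L_def K_def add_eq_0_iff2)
  have "{x::'a. (\<Sum>i<Suc 1. x ^ (2 ^ (h * i))) = 0} = K"
    by (auto simp: L_def add.commute simp flip: L_0)
  then have K_le: "card K \<le> 2 ^ h"
    using card_additive_polynomial_roots_le[OF h_pos, of 1, where ?'a = 'a] by simp
  \<comment> \<open>Telescoping: \<open>T (x ^ (2 ^ h))\<close> is \<open>T x\<close> shifted by one
    place; adding \<open>x\<close> completes the sum, whose surplus last term is
    \<open>x ^ (2 ^ m) = x\<close>.\<close>
  have T_L: "T (L x) = 0" for x
  proof -
    have "T (L x) = (\<Sum>i<Suc (2 * k). x ^ (2 ^ (h * Suc i))) + T x"
      by (simp only: T_def L_def frobenius_add sum.distrib)
        (simp flip: power_mult power_add)
    also have "\<dots> + x = (\<Sum>i<Suc (Suc (2 * k)). x ^ (2 ^ (h * i))) + T x"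
      using sum.lessThan_Suc_shift[of "\<lambda>i. x ^ (2 ^ (h * i))" "Suc (2 * k)"]
      by (simp only: mult_0_right power_0 power_one_right add_ac)
    also have "\<dots> = T x + x ^ (2 ^ (h * Suc (2 * k))) + T x"
      by (simp only: T_def sum.lessThan_Suc[of _ "Suc (2 * k)"])
    also have "\<dots> = (T x + T x) + x"
      using frobenius_m[of x] by (simp only: m_eq Suc_eq_plus1 ac_simps)
    finally show ?thesis
      by simp
  qed
  have "card (range L) \<le> card {x. T x = 0}"
    by (intro card_mono) (auto simp: T_L)
  also have "\<dots> \<le> 2 ^ (h * (2 * k))"
    using card_additive_polynomial_roots_le[OF h_pos, of "2 * k", where ?'a = 'a]
    by (simp add: T_def)
  finally have L_le: "card (range L) \<le> 2 ^ (h * (2 * k))" .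
  \<comment> \<open>The fibres of the additive map \<open>L\<close> are the cosets of its kernel
    \<open>K\<close>.\<close>
  have fibre: "card {x. L x = L z} = card K" for z
  proof (rule bij_betw_same_card)
    show "bij_betw (\<lambda>x. x + z) {x. L x = L z} K"
      by (rule bij_betw_byWitness[where f' = "\<lambda>x. x + z"])
        (auto simp: L_add add.assoc simp flip: L_0)
  qed
  have "2 ^ m = (\<Sum>z\<in>range L. card {x. L x = z})"
    using sum.group[of UNIV "range L" L "\<lambda>_. 1 :: nat"] by (simp flip: card_field)
  also have "\<dots> = (\<Sum>z\<in>range L. card K)"
    by (intro sum.cong) (auto simp: fibre)
  finally have prod: "2 ^ m = card (range L) * card K"
    by simp
  have "2 ^ (h * (2 * k)) * 2 ^ h = (2::nat) ^ m"
    by (simp add: m_eq algebra_simps flip: power_add)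
  also have "\<dots> \<le> 2 ^ (h * (2 * k)) * card K"
    unfolding prod using L_le by simp
  finally show ?thesis
    using K_le by simp
qed

section \<open>The Walsh transform of the Gold function \<open>Tr (y ^ N)\<close> and its first two
  moments\<close>

definition W :: "'a \<Rightarrow> int" where "W b = (\<Sum>y\<in>UNIV. \<chi> (y ^ N + b * y))"

text \<open>As \<open>y ^ N\<close> permutes the field, this is a full character sum. It places the
  excluded parameter \<open>b = 0\<close> in the fibre of the value \<open>0\<close>.\<close>

lemma W_0: "W 0 = 0"
proof -
  have "W 0 = (\<Sum>y\<in>UNIV. \<chi> (y ^ N))"
    by (simp add: W_def)
  also have "\<dots> = (\<Sum>y\<in>UNIV. \<chi> y)"
    by (rule sum.reindex_bij_betw[OF gold_power_bij])
  finally show ?thesis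
    by (simp add: sum_\<chi>)
qed

text \<open>Summing over \<open>b\<close> first annihilates every term except
  \<open>y = 0\<close>.\<close>

lemma sum_W: "(\<Sum>b\<in>UNIV. W b) = 2 ^ m"
proof -
  have "(\<Sum>b\<in>UNIV. W b) = (\<Sum>y\<in>UNIV. \<chi> (y ^ N) * (\<Sum>b\<in>UNIV. \<chi> (y * b)))"
    unfolding W_def
    by (subst sum.swap) (simp only: \<chi>_add sum_distrib_left mult.commute[where 'a = 'a])
  also have "\<dots> = (\<Sum>y\<in>(UNIV :: 'a set). if y = 0 then 2 ^ m else 0)"
    unfolding sum_\<chi>_mult by (intro sum.cong) auto
  finally show ?thesis
    by simp
qed

text \<open>
  \<open>y ^ N + (y + u) ^ N\<close> is \<open>u ^ N\<close> plus terms linear in \<open>y\<close>, whose trace vanishes identically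
  exactly for \<open>u ^ (2 ^ (2 * h)) = u\<close>.
\<close>

lemma sum_\<chi>_derivative:
  "(\<Sum>y\<in>UNIV. \<chi> (y ^ N + (y + u) ^ N)) = (if u \<in> K then 2 ^ m * \<chi> u else 0)"
proof -
  \<comment> \<open>The trace is unchanged when \<open>u ^ (2 ^ h) * y\<close> is raised to the
    power \<open>2 ^ h\<close>; both linear terms then become multiples of
    \<open>y ^ (2 ^ h)\<close>, with total coefficient \<open>c\<close>.\<close>
  define c where "c = u + (u ^ (2 ^ h)) ^ (2 ^ h)"
  have c_0: "c = 0 \<longleftrightarrow> u \<in> K"
    using frobenius_twice_fixed[of u] by (auto simp: c_def K_def add_eq_0_iff2)
  have "\<chi> (y ^ N + (y + u) ^ N) = \<chi> (u ^ N) * \<chi> (c * y ^ (2 ^ h))" for y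
  proof -
    have "y ^ N + (y + u) ^ N = u ^ N + (u * y ^ (2 ^ h) + u ^ (2 ^ h) * y)"
      by (simp add: frobenius_add algebra_simps)
    also have "\<chi> \<dots> = \<chi> (u ^ N) * (\<chi> (u * y ^ (2 ^ h)) * \<chi> ((u ^ (2 ^ h) * y) ^ (2 ^ h)))"
      by (simp only: \<chi>_add \<chi>_frobenius)
    also have "\<dots> = \<chi> (u ^ N) * \<chi> (c * y ^ (2 ^ h))"
      by (simp add: c_def power_mult_distrib distrib_right flip: \<chi>_add)
    finally show ?thesis .
  qed
  then have "(\<Sum>y\<in>UNIV. \<chi> (y ^ N + (y + u) ^ N)) = \<chi> (u ^ N) * (\<Sum>y\<in>UNIV. \<chi> (c * y ^ (2 ^ h)))"
    by (simp add: sum_distrib_left)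
  also have "(\<Sum>y\<in>UNIV. \<chi> (c * y ^ (2 ^ h))) = (\<Sum>y\<in>UNIV. \<chi> (c * y))"
    by (rule sum.reindex_bij_betw[OF frobenius_bij])
  also have "\<dots> = (if u \<in> K then 2 ^ m else 0)"
    by (simp add: sum_\<chi>_mult c_0)
  finally have "(\<Sum>y\<in>UNIV. \<chi> (y ^ N + (y + u) ^ N)) = (if u \<in> K then 2 ^ m * \<chi> (u ^ N) else 0)"
    by simp
  \<comment> \<open>On \<open>K\<close>, \<open>u ^ N = u * u\<close>, and squaring preserves the
    trace.\<close>
  moreover have "\<chi> (u ^ N) = \<chi> u" if "u \<in> K"
    using that \<chi>_frobenius[of u 1] by (simp add: K_def power2_eq_square)
  ultimately show ?thesis
    by simp
qed

text \<open>Substituting \<open>z = y + u\<close> in the second factor cancels \<open>b * y\<close>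
  against itself; the inner sum over \<open>y\<close> is then \<open>sum_\<chi>_derivative\<close>,
  which leaves only the \<open>u\<close> in \<open>K\<close>.\<close>

lemma W_square_sum: "(W b)\<^sup>2 = 2 ^ m * (\<Sum>u\<in>K. \<chi> ((1 + b) * u))"
proof -
  have shift: "(\<Sum>z\<in>UNIV. \<chi> (z ^ N + b * z)) = (\<Sum>u\<in>UNIV. \<chi> ((y + u) ^ N + b * (y + u)))" for y
    by (rule sum.reindex_bij_witness[where i = "\<lambda>u. y + u" and j = "\<lambda>u. y + u"]) auto
  have "(W b)\<^sup>2 = (\<Sum>y\<in>UNIV. \<chi> (y ^ N + b * y) * (\<Sum>z\<in>UNIV. \<chi> (z ^ N + b * z)))"
    by (simp add: W_def power2_eq_square sum_distrib_right)
  also have "\<dots> = (\<Sum>y\<in>UNIV. \<Sum>u\<in>UNIV. \<chi> (y ^ N + b * y) * \<chi> ((y + u) ^ N + b * (y + u)))"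
  proof (intro sum.cong refl)
    fix y
    show "\<chi> (y ^ N + b * y) * (\<Sum>z\<in>UNIV. \<chi> (z ^ N + b * z))
        = (\<Sum>u\<in>UNIV. \<chi> (y ^ N + b * y) * \<chi> ((y + u) ^ N + b * (y + u)))"
      unfolding shift[of y] by (rule sum_distrib_left)
  qed
  also have "\<dots> = (\<Sum>y\<in>UNIV. \<Sum>u\<in>UNIV. \<chi> (b * u) * \<chi> (y ^ N + (y + u) ^ N))"
  proof (intro sum.cong refl)
    fix y u
    have "y ^ N + b * y + ((y + u) ^ N + b * (y + u))
        = b * u + (y ^ N + (y + u) ^ N) + (b * y + b * y)"
      by (simp only: distrib_left ac_simps)
    then show "\<chi> (y ^ N + b * y) * \<chi> ((y + u) ^ N + b * (y + u))
        = \<chi> (b * u) * \<chi> (y ^ N + (y + u) ^ N)"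
      by (simp only: add_self add_0_right flip: \<chi>_add)
  qed
  also have "\<dots> = (\<Sum>u\<in>UNIV. \<chi> (b * u) * (if u \<in> K then 2 ^ m * \<chi> u else 0))"
    by (subst sum.swap) (simp only: sum_\<chi>_derivative flip: sum_distrib_left)
  also have "\<dots> = (\<Sum>u\<in>UNIV. if u \<in> K then 2 ^ m * \<chi> ((1 + b) * u) else 0)"
    by (intro sum.cong refl) (simp add: distrib_right \<chi>_add)
  also have "\<dots> = (\<Sum>u\<in>K. 2 ^ m * \<chi> ((1 + b) * u))"
    by (simp flip: sum.inter_restrict)
  finally show ?thesis
    by (simp add: sum_distrib_left)
qed

text \<open>Parseval's identity: in \<open>W_square_sum\<close>, summing over \<open>b\<close>
  leaves only \<open>u = 0\<close>.\<close>

lemma sum_W_square: "(\<Sum>b\<in>UNIV. (W b)\<^sup>2) = 2 ^ m * 2 ^ m"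
proof -
  have "(\<Sum>b\<in>UNIV. (W b)\<^sup>2) = 2 ^ m * (\<Sum>b\<in>UNIV. \<Sum>u\<in>K. \<chi> ((1 + b) * u))"
    by (simp add: W_square_sum sum_distrib_left)
  also have "(\<Sum>b\<in>UNIV. \<Sum>u\<in>K. \<chi> ((1 + b) * u)) = (\<Sum>u\<in>K. \<chi> u * (\<Sum>b\<in>UNIV. \<chi> (u * b)))"
    by (subst sum.swap)
      (simp only: distrib_left distrib_right mult_1_left mult_1_right \<chi>_add sum_distrib_left
        mult.commute[where 'a = 'a])
  also have "\<dots> = (\<Sum>u\<in>K. if u = 0 then 2 ^ m else 0)"
    unfolding sum_\<chi>_mult by (intro sum.cong) auto
  also have "\<dots> = 2 ^ m"
    using zero_in_K by simp
  finally show ?thesis .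
qed

section \<open>Values of \<open>W\<close> and their frequencies, with
  \<open>R = 2 ^ ((m + h) / 2)\<close>\<close>

definition R :: int where "R = 2 ^ (h * (k + 1))"

lemma R_square: "R\<^sup>2 = 2 ^ m * 2 ^ h"
  by (simp add: R_def m_eq algebra_simps flip: power_add power_mult)

lemma R_pos: "R > 0"
  by (simp add: R_def)

text \<open>By orthogonality on \<open>K\<close> the sum in \<open>W_square_sum\<close> is
  \<open>0\<close> or \<open>2 ^ h\<close>, so the square of \<open>W b\<close> is \<open>0\<close>
  or that of \<open>R\<close>.\<close>

lemma W_values: "W b \<in> {0, R, - R}"
proof -
  have "(\<Sum>u\<in>K. \<chi> ((1 + b) * u)) \<in> {0, int (card K)}"
    using sum_\<chi>_subgroup[of K "1 + b"] K_add by auto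
  then have "(W b)\<^sup>2 = 0 \<or> (W b)\<^sup>2 = R\<^sup>2"
    unfolding W_square_sum R_square card_K by auto
  then show ?thesis
    by (auto simp: power2_eq_iff)
qed

text \<open>Three unknown frequencies are determined by three linear equations: the number of all
  \<open>b\<close>, the sum of \<open>W b\<close> and the sum of its squares.\<close>

lemma card_W:
  shows "card {b. W b = R} = 2 ^ (2 * h * k - 1) + 2 ^ (h * k - 1)"
    and "card {b. W b = - R} = 2 ^ (2 * h * k - 1) - 2 ^ (h * k - 1)"
    and "card {b. W b = 0} = 2 ^ m - 2 ^ (2 * h * k)"
proof -
  define p n z where "p = int (card {b. W b = R})" "n = int (card {b. W b = - R})"
    "z = int (card {b. W b = 0})"
  \<comment> \<open>Half of \<open>2 ^ (h * k)\<close>: the moments become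
    \<open>p + n = 4 * (A * A)\<close> and \<open>p - n = 2 * A\<close>, solvable without
    division.\<close>
  define A :: int where "A = 2 ^ (h * k - 1)"
  have sum_values: "(\<Sum>b\<in>UNIV. f (W b)) = f R * p + f (- R) * n + f 0 * z" for f :: "int \<Rightarrow> int"
  proof -
    have "(\<Sum>b\<in>UNIV. f (W b)) = (\<Sum>s\<in>{R, - R, 0}. \<Sum>b\<in>{b. W b = s}. f (W b))"
      using sum.group[of UNIV "{R, - R, 0}" W "\<lambda>b. f (W b)"] W_values
      by (simp add: image_subset_iff insert_commute)
    then show ?thesis
      using R_pos by (simp add: p_n_z_def)
  qed
  have hk: "h * k > 0"
    using h_pos k_pos by simp
  have A: "2 * A = 2 ^ (h * k)"
    using hk by (simp add: A_def flip: power_Suc)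
  have "(R * R) * (2 * A * (2 * A)) = 2 ^ m * 2 ^ m"
    unfolding A R_def by (simp add: m_eq algebra_simps flip: power_add)
  moreover have "(R * R) * (p + n) = 2 ^ m * 2 ^ m"
    using sum_values[of "\<lambda>w. w\<^sup>2"] sum_W_square by (simp add: power2_eq_square algebra_simps)
  ultimately have "(R * R) * (p + n) = (R * R) * (2 * A * (2 * A))"
    by simp
  then have plus: "p + n = 4 * (A * A)"
    using R_pos by simp
  have "R * (2 * A) = 2 ^ m"
    unfolding A R_def by (simp add: m_eq algebra_simps flip: power_add)
  moreover have "R * (p - n) = 2 ^ m"
    using sum_values[of "\<lambda>w. w"] sum_W by (simp add: algebra_simps)
  ultimately have "R * (p - n) = R * (2 * A)"
    by simp
  then have minus: "p - n = 2 * A"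
    using R_pos by simp
  have total: "p + n + z = 2 ^ m"
    using sum_values[of "\<lambda>_. 1"] by (simp add: card_field)
  have AA: "2 * (A * A) = 2 ^ (2 * h * k - 1)" "4 * (A * A) = 2 ^ (2 * h * k)"
  proof -
    have "2 * A * (2 * A) = 2 ^ (2 * h * k)"
      unfolding A by (simp add: algebra_simps flip: power_add)
    then show "4 * (A * A) = 2 ^ (2 * h * k)"
      by simp
    moreover have "(2::int) ^ (2 * h * k) = 2 * 2 ^ (2 * h * k - 1)"
      using hk by (simp flip: power_Suc)
    ultimately show "2 * (A * A) = 2 ^ (2 * h * k - 1)"
      by simp
  qed
  have "p = 2 * (A * A) + A" "n = 2 * (A * A) - A" "z = 2 ^ m - 4 * (A * A)"
    using plus minus total by linarith+
  \<comment> \<open>Negative terms move to the other side, because subtraction truncates in the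
    natural numbers to which the equations are transferred.\<close>
  then have *: "p = 2 ^ (2 * h * k - 1) + 2 ^ (h * k - 1)"
    "n + 2 ^ (h * k - 1) = 2 ^ (2 * h * k - 1)" "z + 2 ^ (2 * h * k) = 2 ^ m"
    unfolding AA by (simp_all add: A_def)
  have "int (card {b. W b = R}) = int (2 ^ (2 * h * k - 1) + 2 ^ (h * k - 1))"
    "int (card {b. W b = - R} + 2 ^ (h * k - 1)) = int (2 ^ (2 * h * k - 1))"
    "int (card {b. W b = 0} + 2 ^ (2 * h * k)) = int (2 ^ m)"
    using * by (simp_all add: p_n_z_def)
  then show "card {b. W b = R} = 2 ^ (2 * h * k - 1) + 2 ^ (h * k - 1)"
    "card {b. W b = - R} = 2 ^ (2 * h * k - 1) - 2 ^ (h * k - 1)"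
    "card {b. W b = 0} = 2 ^ m - 2 ^ (2 * h * k)"
    unfolding of_nat_eq_iff by linarith+
qed

section \<open>The trace code\<close>

abbreviation D :: "'a set" where "D \<equiv> trace_zero_set m"

definition codeword :: "'a \<Rightarrow> 'a \<Rightarrow> bit" where
  "codeword x = (\<lambda>d. if d \<in> D then abs_trace m (x * d ^ N) else 0)"

lemma trace_code_eq: "trace_code m h D = range codeword"
  by (auto simp: trace_code_def codeword_def)

lemma codeword_add: "codeword (x + y) = codeword x + codeword y"
  by (auto simp: codeword_def fun_eq_iff distrib_right abs_trace_add)

lemma codeword_0 [simp]: "codeword 0 = 0"
  by (auto simp: codeword_def fun_eq_iff)

text \<open>\<open>1 + \<chi> d\<close> is twice the indicator of trace zero, and the nontrivial
  character sums to \<open>0\<close>; the element \<open>0\<close> accounts for the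
  \<open>- 1\<close>.\<close>

lemma card_D: "card D = 2 ^ (m - 1) - 1"
proof -
  have "(\<Sum>d\<in>UNIV. 1 + \<chi> d) = 2 ^ m"
    by (simp add: sum.distrib sum_\<chi> card_field)
  moreover have "(\<Sum>d\<in>UNIV. 1 + \<chi> d) = (\<Sum>d\<in>(UNIV :: 'a set). if abs_trace m d = 0 then 2 else 0)"
    by (intro sum.cong) (auto simp: trace_char_def)
  moreover have "\<dots> = 2 * int (card {d::'a. abs_trace m d = 0})"
    by (simp add: sum.If_cases)
  moreover have "{d::'a. abs_trace m d = 0} = insert 0 D" "0 \<notin> D"
    by (auto simp: trace_zero_set_def)
  moreover have "(2::int) ^ m = 2 * 2 ^ (m - 1)"
    using m_pos by (simp flip: power_Suc)
  ultimately have "int (card D + 1) = int (2 ^ (m - 1))"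
    by simp
  then show ?thesis
    unfolding of_nat_eq_iff by linarith
qed

text \<open>The product \<open>(1 + \<chi> d) * (1 - \<chi> (x * d ^ N))\<close> is four times the
  indicator of the counted positions. Of its four sums only the constant one and the mixed one
  survive.\<close>

lemma weight_codeword:
  assumes "b \<noteq> 0"
  shows "4 * int (hamming_weight D (codeword ((1 / b) ^ N))) = 2 ^ m - W b"
proof -
  define x where "x = (1 / b) ^ N"
  have "x \<noteq> 0"
    using assms by (simp add: x_def)
  have "4 * int (hamming_weight D (codeword x))
      = (\<Sum>d\<in>UNIV. if abs_trace m d = 0 \<and> abs_trace m (x * d ^ N) \<noteq> 0 then 4 else 0)"
  proof -
    have "{d \<in> D. codeword x d \<noteq> 0} = {d. abs_trace m d = 0 \<and> abs_trace m (x * d ^ N) \<noteq> 0}"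
      by (auto simp: codeword_def trace_zero_set_def)
    then show ?thesis
      by (simp add: hamming_weight_def sum.If_cases)
  qed
  also have "\<dots> = (\<Sum>d\<in>UNIV. (1 + \<chi> d) * (1 - \<chi> (x * d ^ N)))"
    by (intro sum.cong) (auto simp: trace_char_def)
  also have "\<dots> = 2 ^ m + (\<Sum>d\<in>UNIV. \<chi> d) - (\<Sum>d\<in>UNIV. \<chi> (x * d ^ N))
      - (\<Sum>d\<in>UNIV. \<chi> (x * d ^ N + d))"
    by (simp add: algebra_simps sum.distrib sum_subtractf \<chi>_add card_field)
  also have "(\<Sum>d\<in>UNIV. \<chi> (x * d ^ N)) = (\<Sum>d\<in>UNIV. \<chi> (x * d))"
    by (rule sum.reindex_bij_betw[OF gold_power_bij])
  also have "\<dots> = 0"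
    using \<open>x \<noteq> 0\<close> by (simp add: sum_\<chi>_mult)
  \<comment> \<open>With \<open>d = b * y\<close>, the choice of \<open>x\<close> turns
    \<open>x * d ^ N\<close> into \<open>y ^ N\<close>.\<close>
  also have "(\<Sum>d\<in>UNIV. \<chi> (x * d ^ N + d)) = W b"
    unfolding W_def
    by (rule sum.reindex_bij_witness[where i = "\<lambda>y. b * y" and j = "\<lambda>d. d / b"])
      (use assms in \<open>auto simp: x_def field_simps\<close>)
  finally show ?thesis
    by (simp add: sum_\<chi> x_def)
qed

lemma gold_inverse_bij: "bij_betw (\<lambda>b::'a. (1 / b) ^ N) (- {0}) (- {0})"
proof -
  have "inj_on (\<lambda>b::'a. (1 / b) ^ N) (- {0})"
    by (intro inj_onI) (metis ComplD gold_power_inj inverse_eq_divide inverse_eq_imp_eq)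
  moreover have "(\<lambda>b::'a. (1 / b) ^ N) ` (- {0}) \<subseteq> - {0}"
    by auto
  ultimately show ?thesis
    by (simp add: bij_betw_def endo_inj_surj)
qed

text \<open>Strict because \<open>k > 0\<close>, that is \<open>h < m\<close>; this keeps the weight
  \<open>(2 ^ m - W b) / 4\<close> positive.\<close>

lemma R_less: "R < 2 ^ m"
proof -
  have "h * (k + 1) < m"
    using h_pos k_pos by (simp add: m_eq)
  then show ?thesis
    unfolding R_def by (intro power_strict_increasing) auto
qed

lemma weight_codeword_pos:
  assumes "x \<noteq> 0"
  shows "hamming_weight D (codeword x) > 0"
proof -
  obtain b where b: "b \<noteq> 0" "x = (1 / b) ^ N"
    using bij_betw_imp_surj_on[OF gold_inverse_bij] assms by blast
  have "W b \<le> R"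
    using W_values[of b] R_pos by auto
  then show ?thesis
    using weight_codeword[OF b(1)] R_less unfolding b(2) by linarith
qed

lemma hamming_weight_0 [simp]: "hamming_weight I 0 = 0"
  by (simp add: hamming_weight_def)

text \<open>By additivity a trivial kernel suffices, and a nonzero parameter gives positive
  weight.\<close>

lemma codeword_inj: "inj codeword"
proof (rule injI)
  fix x y assume "codeword x = codeword y"
  then have "codeword (x + y) = 0"
    unfolding codeword_add by (simp add: fun_eq_iff)
  then have "x + y = 0"
    using weight_codeword_pos[of "x + y"] by fastforce
  then show "x = y"
    by (simp add: add_eq_0_iff2)
qed

text \<open>The dimension comes from counting, since \<open>codeword\<close> is injective on
  \<open>2 ^ m\<close> elements.\<close>

lemma trace_code_linear: "binary_linear_code D (2 ^ (m - 1) - 1) m (trace_code m h D)"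
proof -
  have "F2.subspace (range codeword)"
  proof (rule F2.subspaceI)
    show "0 \<in> range codeword"
      using codeword_0 by (metis rangeI)
    show "u + v \<in> range codeword" if "u \<in> range codeword" "v \<in> range codeword" for u v
      using that by (auto simp flip: codeword_add)
    show "word_scale c u \<in> range codeword" if "u \<in> range codeword" for c u
      using that \<open>0 \<in> range codeword\<close> by (cases c) auto
  qed
  moreover have "F2.dim (range codeword) = m"
    using calculation by (rule F2_dim_eqI) (simp_all add: card_image codeword_inj card_field)
  ultimately show ?thesis
    by (auto simp: binary_linear_code_def trace_code_eq card_D words_def codeword_def)
qed

text \<open>Positive weight excludes the zero codeword; the count then passes from codewords to
  \<open>x \<noteq> 0\<close> and on to \<open>b \<noteq> 0\<close> along bijections.\<close>

lemma weight_count_trace_code: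
  assumes "w > 0"
  shows "weight_count D (trace_code m h D) w = card {b. b \<noteq> 0 \<and> W b = 2 ^ m - 4 * int w}"
proof -
  have "{c \<in> range codeword. hamming_weight D c = w}
      = codeword ` {x \<in> - {0}. hamming_weight D (codeword x) = w}"
    using assms by force
  then have "weight_count D (trace_code m h D) w
      = card {x \<in> - {0}. hamming_weight D (codeword x) = w}"
    by (simp add: weight_count_def trace_code_eq card_image inj_on_subset[OF codeword_inj])
  also have "{x \<in> - {0}. hamming_weight D (codeword x) = w}
      = (\<lambda>b. (1 / b) ^ N) ` {b \<in> - {0}. hamming_weight D (codeword ((1 / b) ^ N)) = w}"
    by (subst bij_betw_imp_surj_on[OF gold_inverse_bij, symmetric]) blast
  also have "card \<dots> = card {b \<in> - {0}. hamming_weight D (codeword ((1 / b) ^ N)) = w}"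
    by (intro card_image inj_on_subset[OF bij_betw_imp_inj_on[OF gold_inverse_bij]]) auto
  also have "{b \<in> - {0}. hamming_weight D (codeword ((1 / b) ^ N)) = w}
      = {b. b \<noteq> 0 \<and> W b = 2 ^ m - 4 * int w}"
    using weight_codeword by (auto, force+)
  finally show ?thesis .
qed

lemma weight_count_trace_code_0: "weight_count D (trace_code m h D) 0 = 1"
proof -
  have "{c \<in> range codeword. hamming_weight D c = 0} = {0}"
    using weight_codeword_pos codeword_0 by (auto, metis less_irrefl, metis rangeI)
  then show ?thesis
    by (simp add: weight_count_def trace_code_eq)
qed

end

section \<open>The weight distribution in terms of \<open>m\<close> and \<open>h\<close>\<close>

theorem theorem1:
  fixes m h :: nat and D0 :: "'a::finite_field set" and C :: "('a \<Rightarrow> bit) set"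
  assumes "m > 0" and "h > 0" and "h dvd m" and "h < m" and "odd (m div h)"
    and "CARD('a) = 2 ^ m"
  defines "D0 \<equiv> trace_zero_set m"
    and "C \<equiv> trace_code m h D0"
  shows "binary_linear_code D0 (2 ^ (m - 1) - 1) m C
    \<and> weight_count D0 C 0 = 1
    \<and> weight_count D0 C (2 ^ (m - 2)) = 2 ^ m - 1 - 2 ^ (m - h)
    \<and> weight_count D0 C (2 ^ (m - 2) - 2 ^ ((m + h - 4) div 2))
        = 2 ^ (m - h - 1) + 2 ^ ((m - h - 2) div 2)
    \<and> weight_count D0 C (2 ^ (m - 2) + 2 ^ ((m + h - 4) div 2))
        = 2 ^ (m - h - 1) - 2 ^ ((m - h - 2) div 2)
    \<and> (\<forall>w. w \<notin> {0, 2 ^ (m - 2), 2 ^ (m - 2) - 2 ^ ((m + h - 4) div 2),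
              2 ^ (m - 2) + 2 ^ ((m + h - 4) div 2)} \<longrightarrow> weight_count D0 C w = 0)"
proof -
  obtain k where k: "m div h = 2 * k + 1"
    using assms(5) by (elim oddE)
  have m_eq: "m = h * (2 * k + 1)"
    using assms(3) k by (metis dvd_mult_div_cancel)
  have "k > 0"
    using assms(4) m_eq by (cases k) auto
  interpret gold m "TYPE('a)" h k
    by standard (use assms \<open>k > 0\<close> m_eq in auto)
  have hk: "h * k \<ge> 1"
    using \<open>h > 0\<close> \<open>k > 0\<close> by (simp add: Suc_le_eq)
  \<comment> \<open>Ensures that \<open>m + h - 4 = 2 * (h * (k + 1)) - 4\<close> is not
    truncated.\<close>
  then have "h * (k + 1) \<ge> 2"
    using \<open>h > 0\<close> unfolding distrib_left by linarith
  define e where "e = (m + h - 4) div 2"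
  \<comment> \<open>The quarters of \<open>R\<close> and \<open>2 ^ m\<close>, so that the nonzero
    weights are \<open>p\<close>, \<open>p - r\<close> and \<open>p + r\<close>.\<close>
  define r p :: nat where "r = 2 ^ e" and "p = 2 ^ (m - 2)"
  have exps: "m - h = 2 * h * k" "(2 * h * k - 2) div 2 = h * k - 1" "h * (k + 1) = e + 2" "m \<ge> 3"
  proof -
    show 1: "m - h = 2 * h * k"
      by (simp add: m_eq)
    show "(2 * h * k - 2) div 2 = h * k - 1"
      by simp
    have "m + h = 2 * (h * (k + 1))"
      by (simp add: m_eq)
    then show "h * (k + 1) = e + 2"
      using \<open>h * (k + 1) \<ge> 2\<close> by (simp add: e_def)
    show "m \<ge> 3"
      using 1 hk \<open>h > 0\<close> by linarith
  qed
  have R: "R = 4 * int r"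
    by (simp only: R_def exps r_def power_add) simp
  have p: "2 ^ m = 4 * int p"
  proof -
    have "m = m - 2 + 2"
      using exps by linarith
    then have "(2::int) ^ m = 2 ^ (m - 2 + 2)"
      by (rule arg_cong)
    then show ?thesis
      by (simp only: p_def power_add) simp
  qed
  \<comment> \<open>\<open>r < p\<close> makes \<open>p - r\<close> an untruncated positive weight,
    so that \<open>count\<close> applies to it.\<close>
  have "r < p" "r > 0"
    using R_less R p by (simp_all add: r_def)
  have nonzero: "{b. b \<noteq> 0 \<and> W b = s} = {b. W b = s}" if "s \<noteq> 0" for s
    using W_0 that by auto
  \<comment> \<open>Only the fibre of \<open>0\<close> loses an element when \<open>b = 0\<close> is
    excluded; this is the \<open>- 1\<close> in the count for weight \<open>p\<close>.\<close>
  have zero: "{b. b \<noteq> 0 \<and> W b = 0} = {b. W b = 0} - {0}"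
    by auto
  have count: "weight_count D0 C w = card {b. b \<noteq> 0 \<and> W b = 4 * int p - 4 * int w}" if "w > 0" for w
    using weight_count_trace_code[OF that] by (simp add: D0_def C_def p)
  have "weight_count D0 C p = 2 ^ m - 1 - 2 ^ (m - h)"
    using count[of p] \<open>r < p\<close> W_0 by (simp add: zero card_W exps)
  moreover have "weight_count D0 C (p - r) = 2 ^ (m - h - 1) + 2 ^ ((m - h - 2) div 2)"
  proof -
    have "4 * int p - 4 * int (p - r) = R"
      using \<open>r < p\<close> by (simp add: R of_nat_diff)
    then show ?thesis
      using count[of "p - r"] \<open>r < p\<close> R_pos by (simp add: nonzero card_W exps)
  qed
  moreover have "weight_count D0 C (p + r) = 2 ^ (m - h - 1) - 2 ^ ((m - h - 2) div 2)"
  proof -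
    have "4 * int p - 4 * int (p + r) = - R"
      by (simp add: R)
    then show ?thesis
      using count[of "p + r"] \<open>r > 0\<close> R_pos by (simp add: nonzero card_W exps)
  qed
  moreover have "weight_count D0 C w = 0" if "w \<notin> {0, p, p - r, p + r}" for w
  proof -
    have "W b \<noteq> 4 * int p - 4 * int w" for b
      using W_values[of b] that \<open>r < p\<close> unfolding R by auto
    then show ?thesis
      using count[of w] that by simp
  qed
  ultimately show ?thesis
    using trace_code_linear weight_count_trace_code_0
    by (auto simp: D0_def C_def r_def p_def e_def)
qed

end
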